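(* If $m$ and $n$ are even integers with $m,n\ge 4$, then there exists a shiftable integer Heffter array $H_s(m,n)$.
   Context: An integer Heffter array $H(m,n)$ is an $m\times n$ array with entries from $\{-mn,\dots,mn\}$ such that every row and every column sums to $0$ over the integers and no element from any pair $\{x,-x\}$ appears twice, so the multiset of absolute values of the entries is exactly $\{1,\dots,mn\}$. It is shiftable, denoted $H_s(m,n)$, if each row and each column contains the same number of positive entries as negative entries. *)

theory Defs
  imports Jordan_Normal_Form.Matrix
begin

text \<open>
  Rows are indexed by \<open>0, \<dots>, m - 1\<close> and columns by \<open>0, \<dots>, n - 1\<close>.  The entry \<open>0\<close> has to be excluded
  explicitly: an array with \<open>m n\<close> entries from \<open>{-m n, \<dots>, m n}\<close> of distinct absolute values could
  otherwise contain \<open>0\<close> and miss one value from \<open>{1, \<dots>, m n}\<close>.  Distinctness of the absolute values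
  says that at most one element of each pair \<open>{x, -x}\<close> occurs, and that it occurs at most once.
\<close>

definition integer_heffter_array :: "nat \<Rightarrow> nat \<Rightarrow> int mat \<Rightarrow> bool" where
  "integer_heffter_array m n A \<longleftrightarrow>
     A \<in> carrier_mat m n \<and>
     (\<forall>i<m. \<forall>j<n. A $$ (i, j) \<in> {- int (m * n)..int (m * n)} - {0}) \<and>
     (\<forall>i<m. (\<Sum>j<n. A $$ (i, j)) = 0) \<and>
     (\<forall>j<n. (\<Sum>i<m. A $$ (i, j)) = 0) \<and>
     inj_on (\<lambda>(i, j). \<bar>A $$ (i, j)\<bar>) ({..<m} \<times> {..<n})"

lemma integer_heffter_array_abs_mset:
  assumes "integer_heffter_array m n A"
  shows "image_mset (\<lambda>(i, j). \<bar>A $$ (i, j)\<bar>) (mset_set ({..<m} \<times> {..<n}))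
         = mset_set {1..int (m * n)}"
proof -
  let ?f = "\<lambda>(i, j). \<bar>A $$ (i, j)\<bar>" and ?C = "{..<m} \<times> {..<n}"
  have inj: "inj_on ?f ?C"
    using assms by (simp add: integer_heffter_array_def)
  have sub: "?f ` ?C \<subseteq> {1..int (m * n)}"
    using assms by (fastforce simp: integer_heffter_array_def)
  have "?f ` ?C = {1..int (m * n)}"
  proof (rule card_subset_eq[OF _ sub])
    show "card (?f ` ?C) = card {1..int (m * n)}"
      unfolding card_image[OF inj] by (simp add: nat_mult_distrib)
  qed simp
  then show ?thesis
    by (simp add: image_mset_mset_set[OF inj])
qed

definition shiftable :: "int mat \<Rightarrow> bool" where
  "shiftable A \<longleftrightarrow>
     (\<forall>i<dim_row A. card {j. j < dim_col A \<and> A $$ (i, j) > 0} = card {j. j < dim_col A \<and> A $$ (i, j) < 0}) \<and>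
     (\<forall>j<dim_col A. card {i. i < dim_row A \<and> A $$ (i, j) > 0} = card {i. i < dim_row A \<and> A $$ (i, j) < 0})"

end

theory Submission imports Defs begin

text \<open>
  In a shiftable array, adding \<open>s\<close> to every positive entry and subtracting \<open>s\<close> from every negative
  entry preserves all row and column sums. Hence an \<open>m \<times> n\<close> array can be juxtaposed with an
  \<open>m \<times> n'\<close> array shifted by \<open>m n\<close>, whose absolute values then start where those of the first array
  end. As every even number that is at least \<open>4\<close> is a sum of \<open>4\<close>s and \<open>6\<close>s, and transposition exchanges
  the two dimensions, explicit arrays of sizes \<open>4 \<times> 4\<close>, \<open>4 \<times> 6\<close> and \<open>6 \<times> 6\<close> suffice.
\<close>

text \<open>The balance of signs is expressed by vanishing sums of signs, so that shifting acts linearly.\<close>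

definition shiftable_entries :: "nat \<Rightarrow> nat \<Rightarrow> (nat \<Rightarrow> nat \<Rightarrow> int) \<Rightarrow> bool" where
  "shiftable_entries m n f \<longleftrightarrow>
     (\<forall>i<m. \<forall>j<n. f i j \<noteq> 0 \<and> \<bar>f i j\<bar> \<le> int (m * n)) \<and>
     (\<forall>i<m. (\<Sum>j<n. f i j) = 0 \<and> (\<Sum>j<n. sgn (f i j)) = 0) \<and>
     (\<forall>j<n. (\<Sum>i<m. f i j) = 0 \<and> (\<Sum>i<m. sgn (f i j)) = 0) \<and>
     inj_on (\<lambda>(i, j). \<bar>f i j\<bar>) ({..<m} \<times> {..<n})"

text \<open>As \<open>sgn\<close> is a difference of two indicators, its sum is a difference of two
  counts.\<close>

lemma sum_sgn_eq_0_iff: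
  fixes f :: "nat \<Rightarrow> int"
  shows "(\<Sum>j<n. sgn (f j)) = 0 \<longleftrightarrow> card {j. j < n \<and> f j > 0} = card {j. j < n \<and> f j < 0}"
proof -
  have "(\<Sum>j<n. sgn (f j)) = (\<Sum>j<n. of_bool (f j > 0) - of_bool (f j < 0))"
    by (rule sum.cong) (auto simp: sgn_if)
  also have "\<dots> = int (card ({..<n} \<inter> {j. f j > 0})) - int (card ({..<n} \<inter> {j. f j < 0}))"
    by (simp add: sum_subtractf)
  also have "{..<n} \<inter> {j. f j > 0} = {j. j < n \<and> f j > 0}"
    by auto
  also have "{..<n} \<inter> {j. f j < 0} = {j. j < n \<and> f j < 0}"
    by auto
  finally show ?thesis by simp
qed

lemma shiftable_entries_imp_heffter:
  assumes "shiftable_entries m n f"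
  defines "A \<equiv> mat m n (\<lambda>(i, j). f i j)"
  shows "integer_heffter_array m n A \<and> shiftable A"
proof
  have entry: "A $$ (i, j) = f i j" if "i < m" "j < n" for i j
    using that by (simp add: A_def)
  have dim: "A \<in> carrier_mat m n" "dim_row A = m" "dim_col A = n"
    by (auto simp: A_def)
  have "inj_on (\<lambda>(i, j). \<bar>A $$ (i, j)\<bar>) ({..<m} \<times> {..<n}) \<longleftrightarrow>
      inj_on (\<lambda>(i, j). \<bar>f i j\<bar>) ({..<m} \<times> {..<n})"
    by (rule inj_on_cong) (auto simp: entry)
  then show "integer_heffter_array m n A"
    using assms(1) unfolding integer_heffter_array_def shiftable_entries_def
    by (auto simp: entry dim abs_le_iff minus_le_iff)
  have row: "(\<Sum>j<n. sgn (A $$ (i, j))) = 0" if "i < m" for i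
    using assms(1) that by (simp add: shiftable_entries_def entry)
  have col: "(\<Sum>i<m. sgn (A $$ (i, j))) = 0" if "j < n" for j
    using assms(1) that by (simp add: shiftable_entries_def entry)
  show "shiftable A"
    unfolding shiftable_def dim using row col by (simp add: sum_sgn_eq_0_iff)
qed

lemma shiftable_entries_transpose:
  assumes "shiftable_entries m n f"
  shows "shiftable_entries n m (\<lambda>i j. f j i)"
  using assms unfolding shiftable_entries_def
  by (auto simp: inj_on_def mult.commute)

lemma sum_lessThan_add:
  fixes F :: "nat \<Rightarrow> 'a::comm_monoid_add"
  shows "(\<Sum>j<n + k. F j) = (\<Sum>j<n. F j) + (\<Sum>j<k. F (n + j))"
  by (induction k) (simp_all add: add.assoc)

text \<open>The shift changes each row and column sum of the right block by \<open>m * n\<close>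
  times a sum of signs, which vanishes. Absolute values cannot collide: those on the left are at
  most \<open>m * n\<close>, those on the right exceed it.\<close>

lemma shiftable_entries_append:
  assumes f: "shiftable_entries m n f" and h: "shiftable_entries m k h"
  defines "g \<equiv> (\<lambda>i j. if j < n then f i j else h i (j - n) + int (m * n) * sgn (h i (j - n)))"
  shows "shiftable_entries m (n + k) g"
proof -
  let ?s = "int (m * n)"
  have g1: "g i j = f i j" if "j < n" for i j
    using that by (simp add: g_def)
  have g2: "g i (n + j) = h i j + ?s * sgn (h i j)" for i j
    by (simp add: g_def)
  \<comment> \<open>A nonnegative shift moves a nonzero \<open>x\<close> away from 0 on its own
    side.\<close>
  have shift: "sgn (x + s * sgn x) = sgn x" "x \<noteq> 0 \<Longrightarrow> \<bar>x + s * sgn x\<bar> = \<bar>x\<bar> + s"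
    if "s \<ge> 0" for x s :: int
    using that by (auto simp: sgn_if)
  have sgn2: "sgn (g i (n + j)) = sgn (h i j)" for i j
    unfolding g2 by (simp add: shift(1))
  have abs2: "\<bar>g i (n + j)\<bar> = \<bar>h i j\<bar> + ?s" if "i < m" "j < k" for i j
    unfolding g2 using h that by (intro shift(2)) (auto simp: shiftable_entries_def)
  have split_col: "j < n \<or> (\<exists>l<k. j = n + l)" if "j < n + k" for j
    using that by presburger
  have low: "\<bar>g i j\<bar> \<le> ?s" if "i < m" "j < n" for i j
    using f that by (simp add: shiftable_entries_def g1)
  have high: "\<bar>g i (n + j)\<bar> > ?s" if "i < m" "j < k" for i j
    using h that by (simp add: shiftable_entries_def abs2)
  have bound: "g i j \<noteq> 0 \<and> \<bar>g i j\<bar> \<le> int (m * (n + k))" if i: "i < m" and j: "j < n + k" for i j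
    using split_col[OF j]
  proof (elim disjE exE conjE)
    assume "j < n"
    have "?s \<le> int (m * (n + k))" by (simp add: algebra_simps)
    with low[OF i \<open>j < n\<close>] have "\<bar>g i j\<bar> \<le> int (m * (n + k))" by linarith
    moreover have "g i j \<noteq> 0"
      using f i \<open>j < n\<close> by (simp add: shiftable_entries_def g1)
    ultimately show ?thesis by blast
  next
    fix l assume l: "l < k" "j = n + l"
    have "\<bar>h i l\<bar> \<le> int (m * k)" using h i l by (simp add: shiftable_entries_def)
    then have "\<bar>g i j\<bar> \<le> int (m * k) + ?s"
      unfolding l(2) abs2[OF i l(1)] by simp
    moreover have "int (m * k) + ?s = int (m * (n + k))" by (simp add: algebra_simps)
    moreover have "g i j \<noteq> 0"
    proof
      assume "g i j = 0"
      with high[OF i l(1)] have "?s < 0" unfolding l(2) by simp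
      then show False using of_nat_less_0_iff by blast
    qed
    ultimately show ?thesis by simp
  qed
  have row: "(\<Sum>j<n + k. g i j) = 0 \<and> (\<Sum>j<n + k. sgn (g i j)) = 0" if "i < m" for i
    unfolding sum_lessThan_add sgn2
    using f h that
    by (simp add: shiftable_entries_def g1 g2 sum.distrib flip: sum_distrib_left)
  have col: "(\<Sum>i<m. g i j) = 0 \<and> (\<Sum>i<m. sgn (g i j)) = 0" if j: "j < n + k" for j
    using split_col[OF j]
  proof (elim disjE exE conjE)
    assume "j < n"
    then show ?thesis using f by (simp add: shiftable_entries_def g1)
  next
    fix l assume l: "l < k" "j = n + l"
    show ?thesis
      unfolding l(2) sgn2 using h l(1)
      by (simp add: shiftable_entries_def g2 sum.distrib flip: sum_distrib_left)
  qed
  \<comment> \<open>Within one block injectivity is inherited; across blocks \<open>low\<close> and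
    \<open>high\<close> contradict \<open>eq\<close>.\<close>
  have "(i, j) = (i', j')"
    if i: "i < m" "i' < m" and j: "j < n + k" "j' < n + k" and eq: "\<bar>g i j\<bar> = \<bar>g i' j'\<bar>"
    for i j i' j'
    using split_col[OF j(1)] split_col[OF j(2)]
  proof (elim disjE exE conjE)
    assume n: "j < n" "j' < n"
    have "inj_on (\<lambda>(i, j). \<bar>f i j\<bar>) ({..<m} \<times> {..<n})"
      using f by (simp add: shiftable_entries_def)
    from inj_onD[OF this, of "(i, j)" "(i', j')"] show ?thesis
      using i n eq by (simp add: g1)
  next
    fix l l' assume l: "l < k" "j = n + l" "l' < k" "j' = n + l'"
    have "inj_on (\<lambda>(i, j). \<bar>h i j\<bar>) ({..<m} \<times> {..<k})"
      using h by (simp add: shiftable_entries_def)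
    from inj_onD[OF this, of "(i, l)" "(i', l')"] show ?thesis
      using i l eq by (simp add: abs2)
  next
    fix l assume "j < n" "l < k" "j' = n + l"
    then show ?thesis using low[of i j] high[of i' l] i eq by simp
  next
    fix l assume "j' < n" "l < k" "j = n + l"
    then show ?thesis using low[of i' j'] high[of i l] i eq by simp
  qed
  then have "inj_on (\<lambda>(i, j). \<bar>g i j\<bar>) ({..<m} \<times> {..<n + k})"
    by (intro inj_onI) force
  with bound row col show ?thesis
    unfolding shiftable_entries_def by blast
qed

text \<open>The bases 4 and 6 cover both even residues modulo 4, so widening only ever has to append
  a block of 4 columns.\<close>

lemma even_ge_4_induct:
  fixes n :: nat
  assumes "even n" "n \<ge> 4"
    and "P 4" "P 6" and add: "\<And>k. P k \<Longrightarrow> P (k + 4)"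
  shows "P n"
  using assms(1,2)
proof (induction n rule: less_induct)
  case (less n)
  show ?case
  proof (cases "n < 8")
    case True
    with less.prems have "n = 4 \<or> n = 6" by presburger
    then show ?thesis using assms(3,4) by blast
  next
    case False
    then have "P (n - 4)" using less.prems by (intro less.IH) auto
    from add[OF this] False show ?thesis by simp
  qed
qed

text \<open>The outer columns use 9 to 16 and the inner ones 1 to 8. In each row the outer pair sums
  to 1 or -1, and the inner pair cancels this.\<close>

lemma shiftable_entries_4_4:
  "shiftable_entries 4 4 (\<lambda>i j.
     [[ 12, -2,  1, -11],
      [-16,  4, -3,  15],
      [ 14, -8,  7, -13],
      [-10,  6, -5,   9]] ! i ! j)"
  \<comment> \<open>The rewriting yields index ranges that \<open>code_simp\<close> can
    enumerate.\<close>
  unfolding shiftable_entries_def lessThan_atLeast0 by code_simp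

text \<open>A checkerboard of signs is possible here: the positive entries total (1 + ... + 24) / 2
  = 150, with 75 in the even rows and 75 in the odd rows.\<close>

lemma shiftable_entries_4_6:
  "shiftable_entries 4 6 (\<lambda>i j.
     [[  5, -20,  18,  -7,   6,  -2],
      [ -1,  11, -22,  16, -21,  17],
      [ 10,  -3,  13, -24,  23, -19],
      [-14,  12,  -9,  15,  -8,   4]] ! i ! j)"
  unfolding shiftable_entries_def lessThan_atLeast0 by code_simp

text \<open>
  The signs of the \<open>6 \<times> 6\<close> array cannot form a checkerboard: if the positive entries of row \<open>i\<close>
  sum to \<open>p i\<close>, the even-numbered columns would force the even and the odd rows to have the same
  total of \<open>p\<close>, but \<open>p 0 + \<dots> + p 5 = (1 + \<dots> + 36) / 2 = 333\<close> is odd.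
\<close>

lemma shiftable_entries_6_6:
  "shiftable_entries 6 6 (\<lambda>i j.
     [[ 33,  16,  25,  -9, -31, -34],
      [-21,   8,   1,  24, -10,  -2],
      [-30, -13,  15,  12,  23,  -7],
      [-20, -17, -26,  14,  27,  22],
      [ 32, -29,  -4, -36,  19,  18],
      [  6,  35, -11,  -5, -28,   3]] ! i ! j)"
  unfolding shiftable_entries_def lessThan_atLeast0 by code_simp

theorem theorem4:
  fixes m n :: nat
  assumes "even m" and "even n" and "m \<ge> 4" and "n \<ge> 4"
  shows "\<exists>A. integer_heffter_array m n A \<and> shiftable A"
proof -
  let ?H = "\<lambda>m n. \<exists>f. shiftable_entries m n f"
  have transpose: "?H k l" if "?H l k" for k l
    using that shiftable_entries_transpose by blast
  have extend: "?H l k" if "?H l 4" "?H l 6" "even k" "k \<ge> 4" for l k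
    using that(3,4,1,2) by (rule even_ge_4_induct) (use that(1) shiftable_entries_append in blast)
  have four: "?H 4 4" "?H 4 6"
    using shiftable_entries_4_4 shiftable_entries_4_6 by blast+
  have six: "?H 6 4" "?H 6 6"
    using four(2) transpose shiftable_entries_6_6 by blast+
  \<comment> \<open>Widening the arrays with 4 and 6 rows to \<open>m\<close> columns and
    transposing gives the two bases for widening to \<open>n\<close> columns.\<close>
  have "?H m 4" "?H m 6"
    using extend[OF four assms(1,3)] extend[OF six assms(1,3)] transpose by blast+
  from extend[OF this assms(2,4)] show ?thesis
    using shiftable_entries_imp_heffter by blast
qed

end
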